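(* Let $T=T(D)$ be a real-valued statistic. The following claims are equivalent: (i) $T$ is a sufficient test statistic and $f_1^{T}(u)/f_0^{T}(u)=u$; (ii) $T$ is a most powerful (MP) statistic for testing the competing hypotheses $H_0$ and $H_1$.
   Context: Setting: $D$ is the observed data, taking values in a measurable space $(\mathbb{X},\Upsilon)$ with a $\sigma$-finite measure $\tau$. A simple null hypothesis $H_0$ is tested against a simple alternative $H_1$. Under $H_k$ ($k\in\{0,1\}$), $D$ has distribution $\Pr_k$ with density $f_k$ with respect to $\tau$, and $f_0(x)>0$, $f_1(x)>0$ for all $x\in\mathbb{X}$. A statistic is a measurable real-valued function of $D$. The likelihood ratio statistic is $\Lambda=\Lambda(D)=f_1(D)/f_0(D)$. Densities of statistics: for statistics $A,B$, $f_k^{A,B}(u,v)$ is the joint density of $(A(D),B(D))$ under $H_k$, and $f_k^{A}(u)$ is the density of $A(D)$ under $H_k$. For each statistic or pair of statistics, the densities for $k=0$ and $k=1$ are taken with respect to a common $\sigma$-finite measure (Lebesgue measure when such densities exist). Identities between densities are understood almost everywhere. $f_k^{A|T}(u,v)$ denotes the conditional density, under $H_k$, of $A$ (at $v$) given $T=u$. Sufficient: $T$ is a sufficient test statistic if $f_1^{A|T}(u,v)=f_0^{A|T}(u,v)$ for each statistic $A=A(D)$ and all $u\ge 0$, $v\in\mathbb{R}$ (i.e. the conditional distribution of $A$ given $T$ is the same under $H_0$ and $H_1$). Most powerful: a test statistic $T$ rejecting $H_0$ when $T>C$ is most powerful if its test has the greatest power $\Pr_1(T>C)$ among all $D$-based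 tests of the same size; $\Lambda$ is such a statistic. Normalization convention: MP statistics are taken in likelihood-ratio form. That is, if a statistic $S=L(\Lambda)$ with $L$ increasing with inverse $W$ is to be used, it is replaced by $T=W(S)=\Lambda$, and this $T$ is called MP. Accordingly, "$T$ is MP" means $T(D)=\Lambda(D)$ with probability one (under $\Pr_0$, equivalently under $\Pr_1$). *)

theory Defs
  imports "HOL-Probability.Probability"
begin

text \<open>
  The data \<open>D\<close> are modelled as the identity on the sample space, so under a hypothesis with
  density \<open>f\<close> the law of \<open>D\<close> is \<open>density \<tau> f\<close> and a statistic is an element of
  \<open>borel_measurable \<tau>\<close>. Below, \<open>P0\<close> and \<open>P1\<close> are the laws of the data under the null hypothesis
  and under the alternative.
\<close>

definition has_density ::
  "'a measure \<Rightarrow> 'b::topological_space measure \<Rightarrow> ('a \<Rightarrow> 'b) \<Rightarrow> ('b \<Rightarrow> real) \<Rightarrow> bool" where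
  "has_density P N X f \<longleftrightarrow>
     sigma_finite_measure N \<and> sets N = sets borel \<and> (\<forall>x. 0 \<le> f x) \<and>
     distributed P N X (\<lambda>x. ennreal (f x))"

text \<open>Conditional density at \<open>v\<close> given the value \<open>u\<close>, from the joint density \<open>g\<close> of
  (conditioning statistic, conditioned statistic) and the density \<open>h\<close> of the conditioning one.\<close>

definition cond_density :: "(real \<times> real \<Rightarrow> real) \<Rightarrow> (real \<Rightarrow> real) \<Rightarrow> real \<Rightarrow> real \<Rightarrow> real" where
  "cond_density g h u v = g (u, v) / h u"

text \<open>
  The densities under the two hypotheses are taken with respect to a common reference measure:
  \<open>M\<close> for the pair \<open>(T, A)\<close> and \<open>N\<close> for \<open>T\<close>. All choices of references and of versions of the
  densities are admitted. Such choices always exist when \<open>P0\<close> and \<open>P1\<close> are equivalent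
  (for instance the laws under \<open>P0\<close>), and no Lebesgue densities or product structure of \<open>M\<close> are
  required; in particular \<open>A\<close> may be a function of \<open>T\<close>. If \<open>M\<close> disintegrates over \<open>N\<close>, the
  quotients are the conditional densities with respect to the disintegration kernel. Another
  choice of \<open>M\<close> or \<open>N\<close> rescales both quotients by the same factor, so whether they agree does not
  depend on it: they agree iff the conditional distributions of \<open>A\<close> given \<open>T\<close> do. The points with
  \<open>h0 u = 0\<close> or \<open>h1 u = 0\<close> are harmless: for equivalent \<open>P0\<close>, \<open>P1\<close> both joint densities
  vanish there \<open>M\<close>-almost everywhere.
\<close>

definition sufficient_statistic :: "'a measure \<Rightarrow> 'a measure \<Rightarrow> ('a \<Rightarrow> real) \<Rightarrow> bool" where
  "sufficient_statistic P0 P1 T \<longleftrightarrow>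
     (\<forall>A \<in> borel_measurable P0. \<forall>M N g0 g1 h0 h1.
        has_density P0 M (\<lambda>x. (T x, A x)) g0 \<longrightarrow>
        has_density P1 M (\<lambda>x. (T x, A x)) g1 \<longrightarrow>
        has_density P0 N T h0 \<longrightarrow>
        has_density P1 N T h1 \<longrightarrow>
        (AE (u, v) in M. 0 \<le> u \<longrightarrow> cond_density g1 h1 u v = cond_density g0 h0 u v))"

text \<open>The ratio is only meaningful where the density of \<open>T\<close> does not vanish, so the identity
  is required almost everywhere with respect to the law of \<open>T\<close>.\<close>

definition density_ratio_is_identity :: "'a measure \<Rightarrow> 'a measure \<Rightarrow> ('a \<Rightarrow> real) \<Rightarrow> bool" where
  "density_ratio_is_identity P0 P1 T \<longleftrightarrow>
     (\<forall>N h0 h1.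
        has_density P0 N T h0 \<longrightarrow>
        has_density P1 N T h1 \<longrightarrow>
        (AE u in distr P0 borel T. h1 u / h0 u = u))"

text \<open>A test based on the data is given by its rejection region \<open>R\<close>; its size is its probability
  under \<open>P0\<close> and its power its probability under \<open>P1\<close>.\<close>

definition greatest_power :: "'a measure \<Rightarrow> 'a measure \<Rightarrow> ('a \<Rightarrow> real) \<Rightarrow> bool" where
  "greatest_power P0 P1 T \<longleftrightarrow>
     (\<forall>C. \<forall>R \<in> sets P0.
        measure P0 R = measure P0 {x \<in> space P0. T x > C} \<longrightarrow>
        measure P1 R \<le> measure P1 {x \<in> space P1. T x > C})"

definition likelihood_ratio :: "('a \<Rightarrow> real) \<Rightarrow> ('a \<Rightarrow> real) \<Rightarrow> 'a \<Rightarrow> real" where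
  "likelihood_ratio f0 f1 x = f1 x / f0 x"

text \<open>Most powerful statistics are normalised to likelihood-ratio form. The first conjunct is the
  optimality property the name refers to; by the Neyman-Pearson lemma it follows from the second.\<close>

definition MP_statistic ::
  "'a measure \<Rightarrow> ('a \<Rightarrow> real) \<Rightarrow> ('a \<Rightarrow> real) \<Rightarrow> ('a \<Rightarrow> real) \<Rightarrow> bool" where
  "MP_statistic \<tau> f0 f1 T \<longleftrightarrow>
     greatest_power (density \<tau> f0) (density \<tau> f1) T \<and>
     (AE x in density \<tau> f0. T x = likelihood_ratio f0 f1 x)"

end

theory Submission
  imports Defs
begin

text \<open>
  Write \<open>P0\<close>, \<open>P1\<close> for the two laws and \<open>L\<close> for the likelihood ratio, so that \<open>P1\<close> has density
  \<open>L > 0\<close> with respect to \<open>P0\<close>. Everything rests on one observation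
  (\<open>density_ratio_of_factor\<close>): if \<open>L = w (X)\<close> almost surely for a statistic \<open>X\<close>, possibly a
  pair, then the two densities of \<open>X\<close> satisfy \<open>g1 = w * g0\<close> almost everywhere.

  If \<open>T = L\<close> almost surely, this applies to \<open>T\<close> with \<open>w u = u\<close> and to \<open>(T, A)\<close> with
  \<open>w (u, v) = u\<close>. The first gives \<open>h1 u = u * h0 u\<close>, which is the identity for the density ratio;
  together with \<open>g1 (u, v) = u * g0 (u, v)\<close> the factor \<open>u\<close> cancels in the conditional densities,
  which is sufficiency. Optimality of the tests \<open>T > C\<close> is the Neyman--Pearson lemma.

  Conversely, let \<open>T\<close> be sufficient with density ratio \<open>u\<close>. Sufficiency is used for the single
  statistic \<open>A = L\<close>, with the laws of \<open>(T, L)\<close> and \<open>T\<close> under \<open>P0\<close> as reference measures. Then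
  \<open>g0 = 1\<close>, \<open>h0 = 1\<close>, while \<open>g1 (u, v) = v\<close> by the observation and \<open>h1 u = u\<close> by hypothesis.
  Equality of the conditional densities reads \<open>v / u = 1\<close>, that is, \<open>L = T\<close> almost surely.
\<close>

section \<open>Densities of statistics\<close>

lemma has_density_distr:
  "has_density P M X g \<Longrightarrow> distr P M X = density M (\<lambda>z. ennreal (g z))"
  by (simp add: has_density_def distributed_def)

lemma has_density_measurable:
  assumes "has_density P M X g"
  shows "X \<in> measurable P M" "g \<in> borel_measurable M"
proof -
  have "(\<lambda>z. enn2real (ennreal (g z))) \<in> borel_measurable M" "\<And>z. 0 \<le> g z"
    using assms by (auto simp: has_density_def distributed_def)
  then show "g \<in> borel_measurable M" by simp
  show "X \<in> measurable P M"
    using assms by (simp add: has_density_def distributed_def)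
qed

lemma density_ratio_of_factor:
  fixes w :: "'b::topological_space \<Rightarrow> ennreal"
  assumes d0: "has_density P0 M X g0" and d1: "has_density (density P0 L) M X g1"
    and L: "L \<in> borel_measurable P0" and w: "w \<in> borel_measurable borel"
    and factor: "AE x in P0. L x = w (X x)"
  shows "AE z in M. ennreal (g1 z) = ennreal (g0 z) * w z"
proof -
  have M: "sigma_finite_measure M" "sets M = sets borel"
    using d0 by (auto simp: has_density_def)
  have w': "w \<in> borel_measurable M"
    using w by (simp add: measurable_cong_sets[OF M(2) refl])
  have X: "X \<in> measurable P0 M" and g: "g0 \<in> borel_measurable M" "g1 \<in> borel_measurable M"
    using has_density_measurable d0 d1 by blast+
  have "density M (\<lambda>z. ennreal (g1 z)) = distr (density P0 L) M X"
    using has_density_distr[OF d1] by simp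
  also have "density P0 L = density P0 (\<lambda>x. w (X x))"
    using L w' X factor by (intro density_cong) auto
  also have "distr \<dots> M X = density (distr P0 M X) w"
    using density_distr[OF w' X] by simp
  also have "\<dots> = density M (\<lambda>z. ennreal (g0 z) * w z)"
    using has_density_distr[OF d0] g w' by (simp add: density_density_eq)
  finally show ?thesis
    using g w' by (subst (asm) sigma_finite_measure.density_unique_iff[OF M(1)]) auto
qed

lemma has_density_AE:
  assumes d: "has_density P M X g" and Q: "{z. Q z} \<in> sets borel"
    and "AE x in P. Q (X x)"
  shows "AE z in M. 0 < g z \<longrightarrow> Q z"
proof -
  have M: "sets M = sets borel" using d by (simp add: has_density_def)
  have "{z \<in> space M. Q z} \<in> sets M"
    using Q M sets_eq_imp_space_eq[OF M] by simp
  then have "AE z in distr P M X. Q z"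
    using assms(3) by (simp add: AE_distr_iff[OF has_density_measurable(1)[OF d]])
  then show ?thesis
    using has_density_measurable(2)[OF d] unfolding has_density_distr[OF d]
    by (simp add: AE_density)
qed

lemma has_density_self:
  assumes "prob_space P" and X: "X \<in> borel_measurable P"
  shows "has_density P (distr P borel X) X (\<lambda>_. 1)"
proof -
  interpret prob_space "distr P borel X"
    using assms by (rule prob_space.prob_space_distr)
  have "distr P (distr P borel X) X = distr P borel X"
    by (intro distr_cong) auto
  then show ?thesis
    using X by (auto simp: has_density_def distributed_def density_1 intro: sigma_finite_measure_axioms)
qed

text \<open>Conversely to \<open>density_ratio_of_factor\<close>, the factor itself serves as a density with respect
  to the law under \<open>P0\<close>.\<close>

lemma has_density_factor:
  assumes "prob_space P0" and X: "X \<in> borel_measurable P0" and w: "w \<in> borel_measurable borel"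
    and nonneg: "\<And>z. 0 \<le> w z" and L: "L \<in> borel_measurable P0"
    and factor: "AE x in P0. L x = ennreal (w (X x))"
  shows "has_density (density P0 L) (distr P0 borel X) X w"
proof -
  have "density P0 L = density P0 (\<lambda>x. ennreal (w (X x)))"
    using L w X factor by (intro density_cong) auto
  moreover have "distr (density P0 (\<lambda>x. ennreal (w (X x)))) borel X
      = density (distr P0 borel X) (\<lambda>z. ennreal (w z))"
    using w X by (intro density_distr[symmetric]) auto
  moreover have "distr (density P0 L) (distr P0 borel X) X = distr (density P0 L) borel X"
    by (intro distr_cong) auto
  ultimately show ?thesis
    using has_density_self[OF assms(1) X] X w nonneg
    by (auto simp: has_density_def distributed_def)
qed

text \<open>Absolute continuity of the law of a statistic is inherited from the data, so Radon--Nikodym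
  supplies its density under the alternative; \<open>real_RN_deriv\<close> chooses a finite version.\<close>

lemma has_density_exists:
  assumes P0: "prob_space P0" and P1: "prob_space (density P0 L)"
    and L: "L \<in> borel_measurable P0" and X: "X \<in> borel_measurable P0"
  shows "\<exists>h. has_density (density P0 L) (distr P0 borel X) X h"
proof -
  let ?N = "distr P0 borel X" and ?N1 = "distr (density P0 L) borel X"
  interpret N: prob_space ?N using P0 X by (rule prob_space.prob_space_distr)
  have X1: "X \<in> borel_measurable (density P0 L)" using X by simp
  interpret N1: prob_space ?N1 using P1 X1 by (rule prob_space.prob_space_distr)
  have ac: "absolutely_continuous ?N ?N1"
    unfolding absolutely_continuous_def
  proof
    fix B assume "B \<in> null_sets ?N"
    then have B: "B \<in> sets borel" and "AE x in P0. X x \<notin> B"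
      using X AE_distrD[OF X, of "\<lambda>u. u \<notin> B"] AE_not_in[of B ?N] by (auto simp: null_sets_def)
    then have "AE x in density P0 L. X x \<notin> B"
      using L by (auto simp: AE_density)
    then have "AE u in ?N1. u \<notin> B"
      using B X1 by (subst AE_distr_iff) auto
    then show "B \<in> null_sets ?N1"
      using B by (simp add: AE_iff_null_sets)
  qed
  obtain h where h: "h \<in> borel_measurable ?N" "AE u in ?N. RN_deriv ?N ?N1 u = ennreal (h u)"
      "\<And>u. 0 \<le> h u"
    by (rule N.real_RN_deriv[OF N1.finite_measure_axioms ac]) auto
  have "density ?N (\<lambda>u. ennreal (h u)) = density ?N (RN_deriv ?N ?N1)"
    using h by (intro density_cong) auto
  also have "\<dots> = ?N1" using ac by (intro N.density_RN_deriv) auto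
  finally have "?N1 = density ?N (\<lambda>u. ennreal (h u))" ..
  moreover have "distr (density P0 L) ?N X = ?N1"
    by (intro distr_cong) auto
  ultimately show ?thesis
    using h X N.sigma_finite_measure_axioms
    by (auto simp: has_density_def distributed_def intro!: exI[of _ h])
qed

section \<open>Properties of the likelihood ratio\<close>

text \<open>The Neyman--Pearson lemma for a statistic that is almost surely the likelihood ratio.\<close>

lemma greatest_power_likelihood_ratio:
  fixes L T :: "'a \<Rightarrow> real"
  assumes P0: "prob_space P0" and P1: "prob_space (density P0 L)"
    and L: "L \<in> borel_measurable P0" and pos: "AE x in P0. 0 < L x"
    and T: "T \<in> borel_measurable P0" and eq: "AE x in P0. T x = L x"
  shows "greatest_power P0 (density P0 L) T"
  unfolding greatest_power_def
proof (intro allI ballI impI)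
  fix C R
  assume R: "R \<in> sets P0"
  define S where "S = {x \<in> space P0. T x > C}"
  assume "measure P0 R = measure P0 {x \<in> space P0. T x > C}"
  then have size: "measure P0 R = measure P0 S" by (simp add: S_def)
  interpret P0: prob_space P0 by fact
  interpret P1: prob_space "density P0 L" by fact
  have nonneg: "AE x in P0. 0 \<le> L x" using pos by eventually_elim simp
  have S: "S \<in> sets P0" using T by (simp add: S_def)
  have power: "measure (density P0 L) B = (\<integral>x. L x * indicator B x \<partial>P0)"
    "integrable P0 (\<lambda>x. L x * indicator B x)" if B: "B \<in> sets P0" for B
  proof -
    have "measure (density P0 L) B = (\<integral>x. indicator B x \<partial>(density P0 L))"
      using B by simp
    also have "\<dots> = (\<integral>x. L x * indicator B x \<partial>P0)"
      using B L nonneg by (subst integral_density) auto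
    finally show "measure (density P0 L) B = (\<integral>x. L x * indicator B x \<partial>P0)" .
    have "integrable (density P0 L) (\<lambda>x. indicator B x :: real)"
      using B by (intro P1.integrable_const_bound[of _ 1]) (auto simp: indicator_def)
    then show "integrable P0 (\<lambda>x. L x * indicator B x)"
      using B L nonneg by (subst (asm) integrable_density) auto
  qed
  have int: "integrable P0 (\<lambda>x. indicator B x :: real)" if "B \<in> sets P0" for B
    using that by (intro P0.integrable_const_bound[of _ 1]) (auto simp: indicator_def)
  \<comment> \<open>Where the regions differ, the sign of \<open>L - C\<close> favours \<open>S\<close>.\<close>
  have "(\<integral>x. L x * indicator R x - C * indicator R x \<partial>P0)
      \<le> (\<integral>x. L x * indicator S x - C * indicator S x \<partial>P0)"
  proof (rule integral_mono_AE)
    show "AE x in P0. L x * indicator R x - C * indicator R x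
        \<le> L x * indicator S x - C * indicator S x"
      using eq sets.sets_into_space[OF R] by (auto simp: S_def indicator_def)
  qed (auto intro!: Bochner_Integration.integrable_diff power(2) int R S)
  then have "measure (density P0 L) R - C * measure P0 R
      \<le> measure (density P0 L) S - C * measure P0 S"
    using R S by (simp add: power int)
  then show "measure (density P0 L) R \<le> measure (density P0 L) {x \<in> space (density P0 L). C < T x}"
    using size by (simp add: S_def)
qed

text \<open>The relation \<open>h1 u = u * h0 u\<close>, stated along \<open>T\<close> under \<open>P0\<close> rather than for the reference
  measure \<open>N\<close> of \<open>T\<close>: in this form it transfers to the reference measure of a pair \<open>(T, A)\<close>,
  which need not be related to \<open>N\<close>.\<close>

lemma marginal_ratio:
  fixes L T :: "'a \<Rightarrow> real"
  assumes L: "L \<in> borel_measurable P0" and pos: "AE x in P0. 0 < L x"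
    and eq: "AE x in P0. T x = L x"
    and d: "has_density P0 N T h0" "has_density (density P0 L) N T h1"
  shows "AE x in P0. 0 < T x \<and> h1 (T x) = T x * h0 (T x) \<and> 0 < h0 (T x)"
proof -
  have nn: "\<And>u. 0 \<le> h0 u" "\<And>u. 0 \<le> h1 u" using d by (auto simp: has_density_def)
  have "AE u in N. ennreal (h1 u) = ennreal (h0 u) * ennreal u"
    using eq L by (intro density_ratio_of_factor[OF d]) auto
  then have "AE u in density N (\<lambda>u. ennreal (h0 u)).
      ennreal (h1 u) = ennreal (h0 u) * ennreal u \<and> 0 < h0 u"
    using has_density_measurable(2)[OF d(1)] by (auto simp: AE_density)
  then have "AE x in P0. ennreal (h1 (T x)) = ennreal (h0 (T x)) * ennreal (T x) \<and> 0 < h0 (T x)"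
    unfolding has_density_distr[OF d(1), symmetric]
    by (rule AE_distrD[OF has_density_measurable(1)[OF d(1)]])
  moreover have "AE x in P0. 0 < T x"
    using eq pos by eventually_elim simp
  ultimately show ?thesis
    by eventually_elim (simp add: nn mult.commute flip: ennreal_mult)
qed

lemma density_ratio_likelihood_ratio:
  fixes L T :: "'a \<Rightarrow> real"
  assumes L: "L \<in> borel_measurable P0" and pos: "AE x in P0. 0 < L x"
    and T: "T \<in> borel_measurable P0" and eq: "AE x in P0. T x = L x"
  shows "density_ratio_is_identity P0 (density P0 L) T"
  unfolding density_ratio_is_identity_def
proof (intro allI impI)
  fix N h0 h1
  assume d: "has_density P0 N T h0" "has_density (density P0 L) N T h1"
  have "sets N = sets borel" using d by (simp add: has_density_def)
  then have [measurable]: "h0 \<in> borel_measurable borel" "h1 \<in> borel_measurable borel"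
    using has_density_measurable(2) d measurable_cong_sets by blast+
  have "AE x in P0. h1 (T x) / h0 (T x) = T x"
    using marginal_ratio[OF L pos eq d] by eventually_elim simp
  then show "AE u in distr P0 borel T. h1 u / h0 u = u"
    using T by (subst AE_distr_iff) auto
qed

lemma sufficient_likelihood_ratio:
  fixes L T :: "'a \<Rightarrow> real"
  assumes L: "L \<in> borel_measurable P0" and pos: "AE x in P0. 0 < L x"
    and eq: "AE x in P0. T x = L x"
  shows "sufficient_statistic P0 (density P0 L) T"
  unfolding sufficient_statistic_def
proof (intro ballI allI impI)
  fix A :: "'a \<Rightarrow> real" and M N g0 g1 h0 h1
  assume A: "A \<in> borel_measurable P0"
    and g: "has_density P0 M (\<lambda>x. (T x, A x)) g0" "has_density (density P0 L) M (\<lambda>x. (T x, A x)) g1"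
    and h: "has_density P0 N T h0" "has_density (density P0 L) N T h1"
  have "sets N = sets borel" using h by (simp add: has_density_def)
  then have [measurable]: "h0 \<in> borel_measurable borel" "h1 \<in> borel_measurable borel"
    using has_density_measurable(2) h measurable_cong_sets by blast+
  have nn: "\<And>z. 0 \<le> g0 z" "\<And>z. 0 \<le> g1 z" using g by (auto simp: has_density_def)
  have "AE z in M. ennreal (g1 z) = ennreal (g0 z) * ennreal (fst z)"
  proof (rule density_ratio_of_factor[OF g])
    show "(\<lambda>z. ennreal (fst z)) \<in> borel_measurable (borel :: (real \<times> real) measure)"
      unfolding borel_prod[symmetric] by measurable
  qed (use eq L in auto)
  \<comment> \<open>The relation between \<open>h0\<close> and \<open>h1\<close> may fail on a set that is not \<open>M\<close>-null, but \<open>g0\<close> vanishes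
     almost everywhere on it, and then so does \<open>g1\<close>.\<close>
  moreover have "AE z in M. 0 < g0 z \<longrightarrow> 0 < fst z \<and> h1 (fst z) = fst z * h0 (fst z)"
  proof (rule has_density_AE[OF g(1)])
    have "{z \<in> space borel. 0 < fst z \<and> h1 (fst z) = fst z * h0 (fst z)}
        \<in> sets (borel :: (real \<times> real) measure)"
      unfolding borel_prod[symmetric] by measurable
    then show "{z. 0 < fst z \<and> h1 (fst z) = fst z * h0 (fst z)}
        \<in> sets (borel :: (real \<times> real) measure)" by simp
    show "AE x in P0. 0 < fst (T x, A x) \<and> h1 (fst (T x, A x)) = fst (T x, A x) * h0 (fst (T x, A x))"
      using marginal_ratio[OF assms h] by eventually_elim simp
  qed
  ultimately have "AE z in M. cond_density g1 h1 (fst z) (snd z) = cond_density g0 h0 (fst z) (snd z)"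
  proof eventually_elim
    case (elim z)
    show ?case
    proof (cases "g0 z = 0")
      case True
      then have "g1 z = 0" using elim nn[of z] by (simp add: ennreal_eq_0_iff)
      with True show ?thesis by (simp add: cond_density_def)
    next
      case False
      with nn(1)[of z] have "0 < g0 z" by simp
      with elim have u: "0 < fst z" "h1 (fst z) = fst z * h0 (fst z)" by auto
      with elim nn[of z] have "g1 z = fst z * g0 z"
        by (simp add: mult.commute flip: ennreal_mult)
      with u show ?thesis by (simp add: cond_density_def)
    qed
  qed
  then show "AE (u, v) in M. 0 \<le> u \<longrightarrow> cond_density g1 h1 u v = cond_density g0 h0 u v"
    by eventually_elim (simp add: case_prod_beta)
qed

section \<open>Sufficiency and the identity ratio characterise the likelihood ratio\<close>

text \<open>Sufficiency is applied to the pair \<open>(T, L)\<close> with the laws under \<open>P0\<close> as references. The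
  density \<open>max 0 v\<close> of the pair under the alternative equals \<open>v\<close> almost everywhere, since \<open>L\<close> is
  almost surely positive; the truncation only makes it nonnegative everywhere.\<close>

lemma sufficient_imp_likelihood_ratio:
  fixes L T :: "'a \<Rightarrow> real"
  assumes P0: "prob_space P0" and P1: "prob_space (density P0 L)"
    and L: "L \<in> borel_measurable P0" and pos: "AE x in P0. 0 < L x"
    and T: "T \<in> borel_measurable P0"
    and suff: "sufficient_statistic P0 (density P0 L) T"
    and ratio: "density_ratio_is_identity P0 (density P0 L) T"
  shows "AE x in P0. T x = L x"
proof -
  let ?M = "distr P0 borel (\<lambda>x. (T x, L x))" and ?N = "distr P0 borel T"
  have TL: "(\<lambda>x. (T x, L x)) \<in> borel_measurable P0" using T L by simp
  obtain h where h: "has_density (density P0 L) ?N T h"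
    using has_density_exists[OF P0 P1 _ T] L by auto
  have one: "has_density P0 ?N T (\<lambda>_. 1)" "has_density P0 ?M (\<lambda>x. (T x, L x)) (\<lambda>_. 1)"
    using has_density_self P0 T TL by blast+
  have g: "has_density (density P0 L) ?M (\<lambda>x. (T x, L x)) (\<lambda>z. max 0 (snd z))"
  proof (rule has_density_factor[OF P0 TL])
    show "(\<lambda>z. max 0 (snd z)) \<in> borel_measurable (borel :: (real \<times> real) measure)"
      unfolding borel_prod[symmetric] by measurable
    show "AE x in P0. ennreal (L x) = ennreal (max 0 (snd (T x, L x)))"
      using pos by eventually_elim simp
  qed (use L in auto)
  have "AE u in ?N. h u / 1 = u"
    using ratio one(1) h unfolding density_ratio_is_identity_def by blast
  then have "AE x in P0. h (T x) = T x" using AE_distrD[OF T] by fastforce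
  moreover have "AE (u, v) in ?M. 0 \<le> u \<longrightarrow>
      cond_density (\<lambda>z. max 0 (snd z)) h u v = cond_density (\<lambda>_. 1) (\<lambda>_. 1) u v"
    using suff L one g h unfolding sufficient_statistic_def by blast
  then have "AE x in P0. 0 \<le> T x \<longrightarrow> max 0 (L x) / h (T x) = 1"
    using AE_distrD[OF TL] by (fastforce simp: cond_density_def)
  moreover note pos
  ultimately show ?thesis
  proof eventually_elim
    case (elim x)
    have "0 \<le> h (T x)" using h by (simp add: has_density_def)
    with elim(1) have "0 \<le> T x" by simp
    \<comment> \<open>\<open>h (T x) = 0\<close> is impossible here, since division by \<open>0\<close> gives \<open>0\<close>.\<close>
    with elim show ?case by (auto simp: divide_eq_1_iff)
  qed
qed

theorem proposition2p5:
  fixes \<tau> :: "'a measure" and f0 f1 T :: "'a \<Rightarrow> real"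
  assumes "sigma_finite_measure \<tau>"
    and "f0 \<in> borel_measurable \<tau>" and "f1 \<in> borel_measurable \<tau>"
    and "\<And>x. x \<in> space \<tau> \<Longrightarrow> f0 x > 0" and "\<And>x. x \<in> space \<tau> \<Longrightarrow> f1 x > 0"
    and "prob_space (density \<tau> f0)" and "prob_space (density \<tau> f1)"
    and "T \<in> borel_measurable \<tau>"
  shows "(sufficient_statistic (density \<tau> f0) (density \<tau> f1) T \<and>
          density_ratio_is_identity (density \<tau> f0) (density \<tau> f1) T)
         \<longleftrightarrow> MP_statistic \<tau> f0 f1 T"
proof -
  let ?L = "likelihood_ratio f0 f1" and ?P0 = "density \<tau> f0"
  have L: "?L \<in> borel_measurable ?P0"
    using assms(2,3) by (simp add: likelihood_ratio_def[abs_def])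
  have pos: "AE x in ?P0. 0 < ?L x"
    using assms(4,5) by (intro AE_I2) (simp add: likelihood_ratio_def)
  have P1: "density \<tau> f1 = density ?P0 ?L"
  proof -
    have "density ?P0 ?L = density \<tau> (\<lambda>x. ennreal (f0 x) * ennreal (?L x))"
      using assms(2) L by (intro density_density_eq) auto
    also have "\<dots> = density \<tau> f1"
    proof (rule density_cong)
      have "ennreal (f0 x) * ennreal (?L x) = ennreal (f1 x)" if "x \<in> space \<tau>" for x
        using assms(4,5)[OF that] by (simp add: likelihood_ratio_def flip: ennreal_mult)
      then show "AE x in \<tau>. ennreal (f0 x) * ennreal (?L x) = ennreal (f1 x)" by auto
    qed (use assms(2,3) L in auto)
    finally show ?thesis ..
  qed
  have T: "T \<in> borel_measurable ?P0" using assms(8) by simp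
  have P1': "prob_space (density ?P0 ?L)" using assms(7) P1 by simp
  show ?thesis
    unfolding MP_statistic_def P1
    using sufficient_imp_likelihood_ratio[OF assms(6) P1' L pos T]
      greatest_power_likelihood_ratio[OF assms(6) P1' L pos T]
      sufficient_likelihood_ratio[OF L pos] density_ratio_likelihood_ratio[OF L pos T]
    by blast
qed

end
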